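(* Let $B=(\beta_n)_{n\in\mathbb Z}$ be a two-way real Cantor base. The infinite sequence $w_B$ is the $S$-adic sequence given by the sequence of substitutions $(\psi_{S^n(B)})_{n\in\mathbb N}$ applied on the letter $0$, i.e., \[ w_B=\lim_{n\to+\infty}\big(\psi_B\circ\psi_{S(B)}\circ\cdots\circ\psi_{S^n(B)}\big)(0). \]
   Context: $\mathbb N=\{0,1,2,\dots\}$. A two-way real Cantor base is a bi-infinite sequence $B=(\beta_n)_{n\in\mathbb Z}$ of real numbers greater than $1$ with $\prod_{n=0}^{\infty}\beta_n=+\infty$ and $\prod_{n=1}^{\infty}\beta_{-n}=+\infty$. For $N\in\mathbb Z$, $S^N(B)$ is the two-way real Cantor base $(\beta_{n+N})_{n\in\mathbb Z}$ (the $n$-th base of $S^N(B)$ is $\beta_{n+N}$), and $S=S^1$. $B$-expansion $d_B(x)$ of a real $x\ge 0$. It is a sequence $(a_n)_{n\in\mathbb Z}$ over $\mathbb N$ with $a_n=0$ for all large $n$, written $\cdots a_1a_0\bullet a_{-1}a_{-2}\cdots$ ($\bullet$ is the radix point; leading zeros may be omitted). If $x\in[0,1)$: put $a_n=0$ for $n\ge 0$, $r_{-1}=x$, and for $n\le -1$ iteratively $a_n=\lfloor\beta_n r_n\rfloor$, $r_{n-1}=\beta_n r_n-a_n$. If $x\ge 1$: let $N\ge0$ be minimal with $x<\beta_N\cdots\beta_0$, put $a_n=0$ for $n>N$, $r_N=x/(\beta_N\cdots\beta_0)$, and for $n\le N$ iteratively $a_n=\lfloor\beta_n r_n\rfloor$,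 $r_{n-1}=\beta_n r_n-a_n$. A $B$-integer is a real $x\ge0$ whose $B$-expansion has only zeros after the radix point ($a_n=0$ for all $n<0$). The set $\mathbb N_B$ of $B$-integers is unbounded without accumulation points; $(x_k)_{k\in\mathbb N}$ is the increasing enumeration of $\mathbb N_B$. For $n\in\mathbb N$, $M_{B,n}=\max\{x\in\mathbb N_B: x<\beta_{n-1}\cdots\beta_0\}$ (empty product $=1$), with $d_B(M_{B,n})=m_{B,n,n-1}\cdots m_{B,n,0}\bullet 0^\omega$. The sequence $w_B=(w_k)_{k\in\mathbb N}$ over the infinite alphabet $\mathbb N$ is defined by: $w_k$ is the greatest $n\in\mathbb N$ such that $d_B(x_k)$ and $d_B(x_{k+1})$ differ at index $n$. The substitution $\psi_B$ over the alphabet $\mathbb N$ is the monoid endomorphism of the free monoid $\mathbb N^*$ defined on letters by $\psi_B(n)=0^{m_{B,n+1,0}}(n+1)$ (the letter $0$ repeated $m_{B,n+1,0}$ times, followed by the letter $n+1$). The substitutions $\psi_{S^n(B)}$ are defined in the same way from the base $S^n(B)$. A sequence of finite words converges to an infinite word $w$ if for every $k$ all but finitely many of these words have the same prefix of length $k$ as $w$. An infinite sequence $v$ is called $S$-adic if there are substitutions $(\sigma_n)_{n\in\mathbb N}$ and a letter $a$ with $v=\lim_{n\to\infty}(\sigma_0\circ\sigma_1\circ\cdots\circ\sigma_n)(a)$. *)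

theory Defs
  imports Complex_Main
begin

definition two_way_cantor_base :: "(int \<Rightarrow> real) \<Rightarrow> bool" where
  "two_way_cantor_base \<beta> \<longleftrightarrow>
     (\<forall>n. \<beta> n > 1) \<and>
     filterlim (\<lambda>n. \<Prod>i<n. \<beta> (int i)) at_top sequentially \<and>
     filterlim (\<lambda>n. \<Prod>i=1..n. \<beta> (- int i)) at_top sequentially"

definition base_shift :: "int \<Rightarrow> (int \<Rightarrow> real) \<Rightarrow> (int \<Rightarrow> real)" where
  "base_shift N \<beta> = (\<lambda>n. \<beta> (n + N))"

text \<open>The product of the \<open>n\<close> bases with indices \<open>n - 1, \<dots>, 0\<close>.\<close>

definition base_prod :: "(int \<Rightarrow> real) \<Rightarrow> nat \<Rightarrow> real" where
  "base_prod \<beta> n = (\<Prod>i<n. \<beta> (int i))"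

text \<open>The index at which the greedy algorithm starts on \<open>x\<close>, and the remainder at that index.\<close>

definition start_index :: "(int \<Rightarrow> real) \<Rightarrow> real \<Rightarrow> int" where
  "start_index \<beta> x =
     (if x < 1 then - 1 else int (LEAST N. x < base_prod \<beta> (Suc N)))"

definition start_rem :: "(int \<Rightarrow> real) \<Rightarrow> real \<Rightarrow> real" where
  "start_rem \<beta> x =
     (if x < 1 then x else x / base_prod \<beta> (Suc (LEAST N. x < base_prod \<beta> (Suc N))))"

text \<open>\<open>greedy_rem \<beta> x k\<close> is the remainder at index \<open>start_index \<beta> x - k\<close>: the indices decrease as
  the algorithm proceeds.\<close>

primrec greedy_rem :: "(int \<Rightarrow> real) \<Rightarrow> real \<Rightarrow> nat \<Rightarrow> real" where
  "greedy_rem \<beta> x 0 = start_rem \<beta> x"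
| "greedy_rem \<beta> x (Suc k) =
     (let y = \<beta> (start_index \<beta> x - int k) * greedy_rem \<beta> x k in y - of_int \<lfloor>y\<rfloor>)"

text \<open>The expansion of a real \<open>x \<ge> 0\<close>. The floor below is then nonnegative, so that \<open>nat\<close> does not
  truncate.\<close>

definition expansion :: "(int \<Rightarrow> real) \<Rightarrow> real \<Rightarrow> (int \<Rightarrow> nat)" where
  "expansion \<beta> x = (\<lambda>n.
     if n > start_index \<beta> x then 0
     else nat \<lfloor>\<beta> n * greedy_rem \<beta> x (nat (start_index \<beta> x - n))\<rfloor>)"

definition B_integers :: "(int \<Rightarrow> real) \<Rightarrow> real set" where
  "B_integers \<beta> = {x. x \<ge> 0 \<and> (\<forall>n<0. expansion \<beta> x n = 0)}"

text \<open>The set of \<open>B\<close>-integers is unbounded and without accumulation points, so it has exactly one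
  increasing enumeration.\<close>

definition B_integer_enum :: "(int \<Rightarrow> real) \<Rightarrow> nat \<Rightarrow> real" where
  "B_integer_enum \<beta> = (THE x. strict_mono x \<and> range x = B_integers \<beta>)"

definition max_B_integer :: "(int \<Rightarrow> real) \<Rightarrow> nat \<Rightarrow> real" where
  "max_B_integer \<beta> n = Max {x \<in> B_integers \<beta>. x < base_prod \<beta> n}"

definition max_digit :: "(int \<Rightarrow> real) \<Rightarrow> nat \<Rightarrow> nat \<Rightarrow> nat" where
  "max_digit \<beta> n i = expansion \<beta> (max_B_integer \<beta> n) (int i)"

definition w_seq :: "(int \<Rightarrow> real) \<Rightarrow> nat \<Rightarrow> nat" where
  "w_seq \<beta> k = (GREATEST n. expansion \<beta> (B_integer_enum \<beta> k) (int n) \<noteq>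
                            expansion \<beta> (B_integer_enum \<beta> (Suc k)) (int n))"

text \<open>Finite words are lists; a substitution is an endomorphism of the free monoid.\<close>

definition substitution :: "('a list \<Rightarrow> 'a list) \<Rightarrow> bool" where
  "substitution \<sigma> \<longleftrightarrow> \<sigma> [] = [] \<and> (\<forall>u v. \<sigma> (u @ v) = \<sigma> u @ \<sigma> v)"

definition psi :: "(int \<Rightarrow> real) \<Rightarrow> nat list \<Rightarrow> nat list" where
  "psi \<beta> u = concat (map (\<lambda>n. replicate (max_digit \<beta> (n + 1) 0) 0 @ [n + 1]) u)"

text \<open>Since the right-hand side has length \<open>k\<close>, the equation below forces \<open>u n\<close> to have length at
  least \<open>k\<close>.\<close>

definition words_converge :: "(nat \<Rightarrow> 'a list) \<Rightarrow> (nat \<Rightarrow> 'a) \<Rightarrow> bool" where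
  "words_converge u w \<longleftrightarrow> (\<forall>k. \<forall>\<^sub>F n in sequentially. take k (u n) = map w [0..<k])"

primrec compose_upto :: "(nat \<Rightarrow> 'a \<Rightarrow> 'a) \<Rightarrow> nat \<Rightarrow> 'a \<Rightarrow> 'a" where
  "compose_upto \<sigma> 0 = \<sigma> 0"
| "compose_upto \<sigma> (Suc n) = compose_upto \<sigma> n \<circ> \<sigma> (Suc n)"

definition S_adic_by :: "(nat \<Rightarrow> 'a list \<Rightarrow> 'a list) \<Rightarrow> 'a \<Rightarrow> (nat \<Rightarrow> 'a) \<Rightarrow> bool" where
  "S_adic_by \<sigma> a v \<longleftrightarrow>
     (\<forall>n. substitution (\<sigma> n)) \<and> words_converge (\<lambda>n. compose_upto \<sigma> n [a]) v"

end

theory Submission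
  imports Defs
begin

text \<open>
  Write \<open>S\<close> for the shift of bases by one place. The theorem follows from the single identity
  \<open>w\<^sub>B = \<psi>\<^sub>B (w\<^bsub>S B\<^esub>)\<close> (lemma \<open>psi_prefix\<close>), where \<open>\<psi>\<^sub>B\<close> acts letter by letter on an infinite
  word: iterating it, \<open>\<psi>\<^sub>B \<circ> \<dots> \<circ> \<psi>\<^bsub>S\<^sup>n B\<^esub>\<close> maps prefixes of \<open>w\<close> for the base \<open>S\<^sup>n\<^sup>+\<^sup>1 B\<close> to prefixes of
  \<open>w\<^sub>B\<close>. All these words begin with the letter \<open>0\<close>, so the images of \<open>0\<close> are prefixes of \<open>w\<^sub>B\<close>, and
  their lengths tend to infinity because the image of \<open>0\<close> under each substitution is \<open>0\<close> followed
  by a nonempty word.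

  For the identity, delete the last digit of a \<open>B\<close>-integer. This leaves an \<open>S B\<close>-integer, and for
  consecutive \<open>S B\<close>-integers \<open>y < y'\<close> the \<open>B\<close>-integers in \<open>[\<beta>\<^sub>0 y, \<beta>\<^sub>0 y')\<close> are exactly the numbers
  \<open>\<beta>\<^sub>0 y + j\<close> with \<open>j\<close> a natural number below \<open>\<beta>\<^sub>0 (y' - y)\<close> (lemmas \<open>B_integer_in_block\<close> and
  \<open>block_B_integer\<close>). A step from \<open>j\<close> to \<open>j + 1\<close> inside this block changes only the digit at index
  \<open>0\<close> and contributes the letter \<open>0\<close>; the final step to \<open>\<beta>\<^sub>0 y'\<close> contributes \<open>n + 1\<close>, where \<open>n\<close> is
  the letter of the pair \<open>y, y'\<close>. The number of steps inside the block depends only on \<open>y' - y\<close>, and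
  by induction on \<open>n\<close> this gap depends only on the letter \<open>n\<close> (lemma \<open>gap_eq\<close>). The pair formed by
  the greatest \<open>S B\<close>-integer below \<open>\<beta>\<^sub>n \<cdots> \<beta>\<^sub>1\<close> and that product itself has the letter \<open>n\<close>, so this
  number of steps is the last digit of the greatest \<open>B\<close>-integer below \<open>\<beta>\<^sub>n \<cdots> \<beta>\<^sub>0\<close>
  (lemma \<open>max_digit_eq\<close>).
\<close>

section \<open>Shifting the base\<close>

lemma base_gt_1: "two_way_cantor_base \<beta> \<Longrightarrow> \<beta> n > 1"
  by (simp add: two_way_cantor_base_def)

lemma base_pos: "two_way_cantor_base \<beta> \<Longrightarrow> \<beta> n > 0"
  using base_gt_1[of \<beta> n] by simp

lemma base_prod_0 [simp]: "base_prod \<beta> 0 = 1"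
  by (simp add: base_prod_def)

lemma base_prod_Suc_shift: "base_prod \<beta> (Suc n) = \<beta> 0 * base_prod (base_shift 1 \<beta>) n"
  unfolding base_prod_def base_shift_def
  by (subst prod.lessThan_Suc_shift) (simp add: add.commute)

lemma base_shift_0 [simp]: "base_shift 0 \<beta> = \<beta>"
  by (simp add: base_shift_def)

lemma base_shift_base_shift: "base_shift M (base_shift N \<beta>) = base_shift (M + N) \<beta>"
  by (simp add: base_shift_def add.assoc)

lemma two_way_cantor_base_shift1:
  assumes "two_way_cantor_base \<beta>"
  shows "two_way_cantor_base (base_shift 1 \<beta>)"
proof -
  have b0: "\<beta> 0 > 0" using base_pos[OF assms] .
  have lim: "filterlim (\<lambda>n. base_prod \<beta> n) at_top sequentially"
    using assms by (simp add: two_way_cantor_base_def base_prod_def)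
  have "filterlim (\<lambda>n. inverse (\<beta> 0) * base_prod \<beta> (Suc n)) at_top sequentially"
    by (rule filterlim_tendsto_pos_mult_at_top[OF tendsto_const])
      (use b0 lim in \<open>simp_all add: filterlim_sequentially_Suc\<close>)
  then have pos: "filterlim (\<lambda>n. \<Prod>i<n. base_shift 1 \<beta> (int i)) at_top sequentially"
    using b0 by (simp add: base_prod_Suc_shift mult.assoc[symmetric] flip: base_prod_def)
  have eq: "(\<Prod>i=1..Suc n. base_shift 1 \<beta> (- int i)) = \<beta> 0 * (\<Prod>i=1..n. \<beta> (- int i))" for n
  proof -
    have "(\<Prod>i=1..Suc n. base_shift 1 \<beta> (- int i)) =
        base_shift 1 \<beta> (- 1) * (\<Prod>i=Suc 1..Suc n. base_shift 1 \<beta> (- int i))"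
      by (subst prod.atLeast_Suc_atMost) simp_all
    also have "\<dots> = \<beta> 0 * (\<Prod>i=1..n. \<beta> (- int i))"
      by (subst prod.atLeast_Suc_atMost_Suc_shift) (simp add: base_shift_def)
    finally show ?thesis .
  qed
  have "filterlim (\<lambda>n. \<beta> 0 * (\<Prod>i=1..n. \<beta> (- int i))) at_top sequentially"
    by (rule filterlim_tendsto_pos_mult_at_top[OF tendsto_const])
      (use b0 assms in \<open>simp_all add: two_way_cantor_base_def\<close>)
  then have "filterlim (\<lambda>n. \<Prod>i=1..Suc n. base_shift 1 \<beta> (- int i)) at_top sequentially"
    unfolding eq .
  then have neg: "filterlim (\<lambda>n. \<Prod>i=1..n. base_shift 1 \<beta> (- int i)) at_top sequentially"
    by (rule filterlim_sequentially_Suc[THEN iffD1])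
  show ?thesis
    using assms pos neg by (simp add: two_way_cantor_base_def base_shift_def)
qed

lemma two_way_cantor_base_shift:
  assumes "two_way_cantor_base \<beta>"
  shows "two_way_cantor_base (base_shift (int n) \<beta>)"
proof (induction n)
  case (Suc n)
  then show ?case
    using two_way_cantor_base_shift1 base_shift_base_shift[of 1 "int n" \<beta>]
    by (metis of_nat_Suc)
qed (use assms in simp)

lemma ex_less_base_prod:
  assumes "two_way_cantor_base \<beta>"
  shows "\<exists>n. x < base_prod \<beta> n"
proof -
  have "filterlim (\<lambda>n. base_prod \<beta> n) at_top sequentially"
    using assms by (simp add: two_way_cantor_base_def base_prod_def)
  then have "\<forall>\<^sub>F n in sequentially. x < base_prod \<beta> n"
    by (simp add: filterlim_at_top_dense)
  then show ?thesis
    by (meson eventually_happens' sequentially_bot)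
qed

text \<open>Dividing by \<open>\<beta> 0\<close> and shifting the base brings every nonnegative number below \<open>1\<close> after
  finitely many steps.\<close>

lemma shift_induct [consumes 2, case_names less_1 shift]:
  assumes "two_way_cantor_base \<beta>" "0 \<le> x"
    and base: "\<And>\<beta> x. two_way_cantor_base \<beta> \<Longrightarrow> 0 \<le> x \<Longrightarrow> x < 1 \<Longrightarrow> Q \<beta> x"
    and step: "\<And>\<beta> x. two_way_cantor_base \<beta> \<Longrightarrow> two_way_cantor_base (base_shift 1 \<beta>) \<Longrightarrow> 0 \<le> x
      \<Longrightarrow> Q (base_shift 1 \<beta>) (x / \<beta> 0) \<Longrightarrow> Q \<beta> x"
  shows "Q \<beta> x"
proof -
  obtain n where "x < base_prod \<beta> n"
    using ex_less_base_prod assms(1) by blast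
  then show ?thesis
    using assms(1,2)
  proof (induction n arbitrary: \<beta> x)
    case 0
    then show ?case using base by simp
  next
    case (Suc n)
    have b0: "\<beta> 0 > 0" using base_pos Suc.prems by blast
    have "x / \<beta> 0 < base_prod (base_shift 1 \<beta>) n"
      using Suc.prems b0 by (simp add: base_prod_Suc_shift field_simps)
    moreover have T: "two_way_cantor_base (base_shift 1 \<beta>)"
      using two_way_cantor_base_shift1 Suc.prems by blast
    ultimately have "Q (base_shift 1 \<beta>) (x / \<beta> 0)"
      using Suc b0 by simp
    then show ?case using step Suc.prems T by blast
  qed
qed

section \<open>Digits and integer parts\<close>

text \<open>The number of digits before the radix point, leading zeros not counted.\<close>

definition int_length :: "(int \<Rightarrow> real) \<Rightarrow> real \<Rightarrow> nat" where
  "int_length \<beta> x = (LEAST n. x < base_prod \<beta> n)"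

text \<open>The remainder of the greedy algorithm once the digit at index \<open>0\<close> has been produced, that is,
  the part of \<open>x\<close> represented after the radix point.\<close>

definition frac_part :: "(int \<Rightarrow> real) \<Rightarrow> real \<Rightarrow> real" where
  "frac_part \<beta> x = greedy_rem \<beta> x (int_length \<beta> x)"

text \<open>The part of \<open>x\<close> represented before the radix point. It turns out to be the greatest
  \<open>B\<close>-integer not exceeding \<open>x\<close>.\<close>

definition int_part :: "(int \<Rightarrow> real) \<Rightarrow> real \<Rightarrow> real" where
  "int_part \<beta> x = x - frac_part \<beta> x"

lemma int_length_less_1: "x < 1 \<Longrightarrow> int_length \<beta> x = 0"
  unfolding int_length_def by (rule Least_equality) simp_all

lemma int_length_ge_1:
  assumes "two_way_cantor_base \<beta>" "1 \<le> x"
  shows "int_length \<beta> x = Suc (LEAST n. x < base_prod \<beta> (Suc n))"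
proof -
  obtain n where "x < base_prod \<beta> n"
    using ex_less_base_prod assms(1) by blast
  then show ?thesis
    unfolding int_length_def using assms(2) by (intro Least_Suc[of _ n]) auto
qed

lemma int_length_shift:
  assumes "two_way_cantor_base \<beta>" "1 \<le> x"
  shows "int_length \<beta> x = Suc (int_length (base_shift 1 \<beta>) (x / \<beta> 0))"
proof -
  have "x < base_prod \<beta> (Suc n) \<longleftrightarrow> x / \<beta> 0 < base_prod (base_shift 1 \<beta>) n" for n
    using base_pos[OF assms(1), of 0] by (simp add: base_prod_Suc_shift field_simps)
  then show ?thesis
    using int_length_ge_1[OF assms] by (simp add: int_length_def)
qed

lemma start_index_eq:
  assumes "two_way_cantor_base \<beta>"
  shows "start_index \<beta> x = int (int_length \<beta> x) - 1"
  using int_length_ge_1[OF assms, of x] int_length_less_1[of x \<beta>]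
  by (cases "x < 1") (simp_all add: start_index_def)

lemma start_rem_eq:
  assumes "two_way_cantor_base \<beta>"
  shows "start_rem \<beta> x = x / base_prod \<beta> (int_length \<beta> x)"
  using int_length_ge_1[OF assms, of x] int_length_less_1[of x \<beta>]
  by (cases "x < 1") (simp_all add: start_rem_def)

lemma greedy_rem_shift:
  assumes "two_way_cantor_base \<beta>" "1 \<le> x"
  shows "greedy_rem \<beta> x k = greedy_rem (base_shift 1 \<beta>) (x / \<beta> 0) k"
proof (induction k)
  case 0
  show ?case
    using start_rem_eq assms int_length_shift[OF assms] two_way_cantor_base_shift1[OF assms(1)]
    by (simp add: base_prod_Suc_shift)
next
  case (Suc k)
  have "\<beta> (start_index \<beta> x - int k) =
      base_shift 1 \<beta> (start_index (base_shift 1 \<beta>) (x / \<beta> 0) - int k)"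
    using start_index_eq assms(1) int_length_shift[OF assms] two_way_cantor_base_shift1[OF assms(1)]
    by (simp add: base_shift_def)
  then show ?case using Suc by simp
qed

lemma frac_part_less_1: "x < 1 \<Longrightarrow> frac_part \<beta> x = x"
  by (simp add: frac_part_def int_length_less_1 start_rem_def)

lemma frac_part_shift:
  assumes "two_way_cantor_base \<beta>" "0 \<le> x"
  shows "frac_part \<beta> x = \<beta> 0 * frac_part (base_shift 1 \<beta>) (x / \<beta> 0)
    - of_int \<lfloor>\<beta> 0 * frac_part (base_shift 1 \<beta>) (x / \<beta> 0)\<rfloor>"
proof (cases "x < 1")
  case True
  have "x / \<beta> 0 < 1" using True base_gt_1[OF assms(1), of 0] by simp
  then have "\<beta> 0 * frac_part (base_shift 1 \<beta>) (x / \<beta> 0) = x"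
    using base_gt_1[OF assms(1), of 0] by (simp add: frac_part_less_1)
  moreover have "\<lfloor>x\<rfloor> = 0" using True assms(2) by linarith
  ultimately show ?thesis using True by (simp add: frac_part_less_1)
next
  case False
  then show ?thesis
    using int_length_shift[OF assms(1), of x] greedy_rem_shift[OF assms(1), of x]
      start_index_eq[OF assms(1), of x]
    by (simp add: frac_part_def Let_def)
qed

lemma expansion_0:
  assumes "two_way_cantor_base \<beta>" "0 \<le> x"
  shows "expansion \<beta> x 0 = nat \<lfloor>\<beta> 0 * frac_part (base_shift 1 \<beta>) (x / \<beta> 0)\<rfloor>"
proof (cases "x < 1")
  case True
  have "x / \<beta> 0 < 1" using True base_gt_1[OF assms(1), of 0] by simp
  then have "\<beta> 0 * frac_part (base_shift 1 \<beta>) (x / \<beta> 0) = x"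
    using base_gt_1[OF assms(1), of 0] by (simp add: frac_part_less_1)
  moreover have "\<lfloor>x\<rfloor> = 0" using True assms(2) by linarith
  ultimately show ?thesis using True by (simp add: expansion_def start_index_def)
next
  case False
  then show ?thesis
    using int_length_shift[OF assms(1), of x] greedy_rem_shift[OF assms(1), of x]
      start_index_eq[OF assms(1), of x]
    by (simp add: expansion_def frac_part_def)
qed

lemma expansion_Suc:
  assumes "two_way_cantor_base \<beta>" "0 \<le> x"
  shows "expansion \<beta> x (int (Suc i)) = expansion (base_shift 1 \<beta>) (x / \<beta> 0) (int i)"
proof (cases "x < 1")
  case True
  have "x / \<beta> 0 < 1" using True base_gt_1[OF assms(1), of 0] by simp
  then show ?thesis using True by (simp add: expansion_def start_index_def)
next
  case False
  have "start_index \<beta> x = start_index (base_shift 1 \<beta>) (x / \<beta> 0) + 1"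
    using False start_index_eq assms(1) int_length_shift[OF assms(1), of x]
      two_way_cantor_base_shift1[OF assms(1)]
    by simp
  then show ?thesis
    using False greedy_rem_shift[OF assms(1), of x]
    by (simp add: expansion_def base_shift_def add.commute)
qed

lemma int_part_less_1: "x < 1 \<Longrightarrow> int_part \<beta> x = 0"
  by (simp add: int_part_def frac_part_less_1)

text \<open>The integer part of \<open>x\<close> arises from that of \<open>x / \<beta> 0\<close> by appending the digit at index
  \<open>0\<close>.\<close>

lemma int_part_shift:
  assumes "two_way_cantor_base \<beta>" "0 \<le> x"
  defines "q \<equiv> int_part (base_shift 1 \<beta>) (x / \<beta> 0)"
  shows "int_part \<beta> x = \<beta> 0 * q + of_int \<lfloor>x - \<beta> 0 * q\<rfloor>"
    and "expansion \<beta> x 0 = nat \<lfloor>x - \<beta> 0 * q\<rfloor>"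
proof -
  have "\<beta> 0 * frac_part (base_shift 1 \<beta>) (x / \<beta> 0) = x - \<beta> 0 * q"
    using base_pos[OF assms(1), of 0] by (simp add: q_def int_part_def field_simps)
  then show "int_part \<beta> x = \<beta> 0 * q + of_int \<lfloor>x - \<beta> 0 * q\<rfloor>"
    and "expansion \<beta> x 0 = nat \<lfloor>x - \<beta> 0 * q\<rfloor>"
    using frac_part_shift[OF assms(1,2)] expansion_0[OF assms(1,2)]
    by (simp_all add: int_part_def)
qed

lemma int_part_bounds:
  assumes "two_way_cantor_base \<beta>" "0 \<le> x"
  shows "0 \<le> int_part \<beta> x \<and> int_part \<beta> x \<le> x \<and> x < int_part \<beta> x + 1"
  using assms
proof (induction rule: shift_induct)
  case (less_1 \<beta> x)
  then show ?case by (simp add: int_part_less_1)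
next
  case (shift \<beta> x)
  define q where "q = int_part (base_shift 1 \<beta>) (x / \<beta> 0)"
  have b0: "\<beta> 0 > 0" using base_pos shift.hyps by blast
  have "0 \<le> q" "q \<le> x / \<beta> 0" using shift.IH by (simp_all add: q_def)
  then have "0 \<le> \<beta> 0 * q" "0 \<le> x - \<beta> 0 * q" using b0 by (simp_all add: field_simps)
  moreover have "int_part \<beta> x = \<beta> 0 * q + of_int \<lfloor>x - \<beta> 0 * q\<rfloor>"
    using int_part_shift(1) shift.hyps by (simp add: q_def)
  moreover have "0 \<le> \<lfloor>x - \<beta> 0 * q\<rfloor>" using \<open>0 \<le> x - \<beta> 0 * q\<close> by simp
  ultimately show ?case by (intro conjI; linarith)
qed

text \<open>Monotonicity and idempotence need each other in the induction. The last conjunct says that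
  passing to the integer part does not affect the digits above index \<open>0\<close>.\<close>

lemma int_part_mono_idem:
  assumes "two_way_cantor_base \<beta>" "0 \<le> z"
  shows "\<forall>x y. 0 \<le> x \<and> x \<le> y \<and> y \<le> z \<longrightarrow>
    int_part \<beta> x \<le> int_part \<beta> y \<and> int_part \<beta> (int_part \<beta> y) = int_part \<beta> y \<and>
    int_part (base_shift 1 \<beta>) (int_part \<beta> y / \<beta> 0) = int_part (base_shift 1 \<beta>) (y / \<beta> 0)"
  using assms
proof (induction rule: shift_induct)
  case (less_1 \<beta> z)
  have "y / \<beta> 0 < 1" if "0 \<le> y" "y \<le> z" for y
    using base_gt_1[of \<beta> 0] less_1 that by (simp add: field_simps)
  then show ?case using less_1 by (simp add: int_part_less_1)
next
  case (shift \<beta> z)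
  define ip where "ip = int_part (base_shift 1 \<beta>)"
  have b0: "\<beta> 0 > 0" using base_pos shift.hyps by blast
  have mono: "ip x \<le> ip y" and idem: "ip (ip y) = ip y" if "0 \<le> x" "x \<le> y" "y \<le> z / \<beta> 0" for x y
    using shift.IH that by (auto simp: ip_def)
  have bd: "0 \<le> ip x" "ip x \<le> x" if "0 \<le> x" for x
    using int_part_bounds shift.hyps that by (auto simp: ip_def)
  have rec: "int_part \<beta> x = \<beta> 0 * ip (x / \<beta> 0) + of_int \<lfloor>x - \<beta> 0 * ip (x / \<beta> 0)\<rfloor>"
    if "0 \<le> x" for x
    using int_part_shift(1) shift.hyps that by (simp add: ip_def)
  show ?case
  proof (intro allI impI, elim conjE)
    fix x y assume xy: "0 \<le> x" "x \<le> y" "y \<le> z"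
    define p q where "p = ip (x / \<beta> 0)" and "q = ip (y / \<beta> 0)"
    have y0: "0 \<le> y" using xy by simp
    have le: "0 \<le> x / \<beta> 0" "x / \<beta> 0 \<le> y / \<beta> 0" "y / \<beta> 0 \<le> z / \<beta> 0"
      using xy b0 by (simp_all add: field_simps)
    have q: "0 \<le> q" "q \<le> y / \<beta> 0" using bd[of "y / \<beta> 0"] le by (simp_all add: q_def)
    have qy: "\<beta> 0 * q \<le> y" using q b0 by (simp add: field_simps)
    have idq: "ip q = q" using idem[of "y / \<beta> 0" "y / \<beta> 0"] le by (simp add: q_def)
    have ipy: "int_part \<beta> y = \<beta> 0 * q + of_int \<lfloor>y - \<beta> 0 * q\<rfloor>"
      using rec y0 by (simp add: q_def)
    have ipx: "int_part \<beta> x = \<beta> 0 * p + of_int \<lfloor>x - \<beta> 0 * p\<rfloor>"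
      using rec xy by (simp add: p_def)
    have lo: "\<beta> 0 * q \<le> int_part \<beta> y" using ipy qy by simp
    have hi: "int_part \<beta> y \<le> y" and ip0: "0 \<le> int_part \<beta> y"
      using int_part_bounds[of \<beta> y] shift.hyps y0 by simp_all
    have "q \<le> int_part \<beta> y / \<beta> 0" "int_part \<beta> y / \<beta> 0 \<le> y / \<beta> 0"
      using lo hi b0 by (simp_all add: field_simps)
    then have keep: "ip (int_part \<beta> y / \<beta> 0) = q"
      using mono[of q "int_part \<beta> y / \<beta> 0"] mono[of "int_part \<beta> y / \<beta> 0" "y / \<beta> 0"] q idq le
      by (simp add: q_def)
    have "p \<le> q" using mono le by (simp add: p_def q_def)
    have "int_part \<beta> x \<le> int_part \<beta> y"
    proof (cases "p = q")
      case True
      have "\<lfloor>x - \<beta> 0 * q\<rfloor> \<le> \<lfloor>y - \<beta> 0 * q\<rfloor>" using xy by (intro floor_mono) simp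
      then show ?thesis using ipx ipy True by simp
    next
      case False
      have "x / \<beta> 0 < q"
      proof (rule ccontr)
        assume "\<not> x / \<beta> 0 < q"
        then have "q \<le> p" using mono[of q "x / \<beta> 0"] idq q le by (simp add: p_def)
        then show False using False \<open>p \<le> q\<close> by simp
      qed
      then have "x < \<beta> 0 * q" using b0 by (simp add: field_simps)
      moreover have "int_part \<beta> x \<le> x" using int_part_bounds[of \<beta> x] shift.hyps xy by simp
      ultimately show ?thesis using lo by simp
    qed
    moreover have "int_part \<beta> (int_part \<beta> y) = int_part \<beta> y"
      using rec[OF ip0] keep ipy by simp
    ultimately show "int_part \<beta> x \<le> int_part \<beta> y \<and>
        int_part \<beta> (int_part \<beta> y) = int_part \<beta> y \<and>
        int_part (base_shift 1 \<beta>) (int_part \<beta> y / \<beta> 0) = int_part (base_shift 1 \<beta>) (y / \<beta> 0)"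
      using keep by (simp add: ip_def q_def)
  qed
qed

lemma int_part_mono:
  assumes "two_way_cantor_base \<beta>" "0 \<le> x" "x \<le> y"
  shows "int_part \<beta> x \<le> int_part \<beta> y"
  using int_part_mono_idem[of \<beta> y] assms by auto

lemma int_part_idem:
  assumes "two_way_cantor_base \<beta>" "0 \<le> x"
  shows "int_part \<beta> (int_part \<beta> x) = int_part \<beta> x"
  using int_part_mono_idem[of \<beta> x] assms by auto

lemma int_part_shift_int_part:
  assumes "two_way_cantor_base \<beta>" "0 \<le> x"
  shows "int_part (base_shift 1 \<beta>) (int_part \<beta> x / \<beta> 0) = int_part (base_shift 1 \<beta>) (x / \<beta> 0)"
  using int_part_mono_idem[of \<beta> x] assms by auto

lemma expansion_eq_if_int_part_eq_aux:
  assumes "two_way_cantor_base \<beta>" "0 \<le> z"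
  shows "\<forall>x y i. 0 \<le> x \<and> x \<le> z \<and> 0 \<le> y \<and> y \<le> z \<and> int_part \<beta> x = int_part \<beta> y \<longrightarrow>
    expansion \<beta> x (int i) = expansion \<beta> y (int i)"
  using assms
proof (induction rule: shift_induct)
  case (less_1 \<beta> z)
  then show ?case by (simp add: expansion_def start_index_def)
next
  case (shift \<beta> z)
  have b0: "\<beta> 0 > 0" using base_pos shift.hyps by blast
  show ?case
  proof (intro allI impI, elim conjE)
    fix x y i
    assume xy: "0 \<le> x" "x \<le> z" "0 \<le> y" "y \<le> z" and eq: "int_part \<beta> x = int_part \<beta> y"
    have keep: "int_part (base_shift 1 \<beta>) (x / \<beta> 0) = int_part (base_shift 1 \<beta>) (y / \<beta> 0)"
      using int_part_shift_int_part[OF shift.hyps(1) xy(1)]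
        int_part_shift_int_part[OF shift.hyps(1) xy(3)] eq by simp
    show "expansion \<beta> x (int i) = expansion \<beta> y (int i)"
    proof (cases i)
      case 0
      show ?thesis
        using int_part_shift[of \<beta> x] int_part_shift[of \<beta> y] shift.hyps xy eq keep 0 by simp
    next
      case (Suc j)
      have "x / \<beta> 0 \<le> z / \<beta> 0" "y / \<beta> 0 \<le> z / \<beta> 0" "0 \<le> x / \<beta> 0" "0 \<le> y / \<beta> 0"
        using xy b0 by (simp_all add: divide_right_mono)
      then have "expansion (base_shift 1 \<beta>) (x / \<beta> 0) (int j)
          = expansion (base_shift 1 \<beta>) (y / \<beta> 0) (int j)"
        using shift.IH keep by blast
      then show ?thesis
        unfolding Suc expansion_Suc[OF shift.hyps(1) xy(1)] expansion_Suc[OF shift.hyps(1) xy(3)] .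
    qed
  qed
qed

lemma expansion_eq_if_int_part_eq:
  assumes "two_way_cantor_base \<beta>" "0 \<le> x" "0 \<le> y" "int_part \<beta> x = int_part \<beta> y"
  shows "expansion \<beta> x (int i) = expansion \<beta> y (int i)"
  using expansion_eq_if_int_part_eq_aux[of \<beta> "max x y"] assms by auto

lemma greedy_rem_after_point:
  assumes "two_way_cantor_base \<beta>" "0 \<le> x"
  shows "0 \<le> frac_part \<beta> x" "frac_part \<beta> x < 1"
    and "expansion \<beta> x (- 1 - int k) =
      nat \<lfloor>\<beta> (- 1 - int k) * greedy_rem \<beta> x (int_length \<beta> x + k)\<rfloor>"
    and "greedy_rem \<beta> x (int_length \<beta> x + Suc k) =
      (let y = \<beta> (- 1 - int k) * greedy_rem \<beta> x (int_length \<beta> x + k) in y - of_int \<lfloor>y\<rfloor>)"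
proof -
  show "0 \<le> frac_part \<beta> x" "frac_part \<beta> x < 1"
    using int_part_bounds[OF assms] by (simp_all add: int_part_def)
  have s: "start_index \<beta> x = int (int_length \<beta> x) - 1" using start_index_eq assms by blast
  have "nat (start_index \<beta> x - (- 1 - int k)) = int_length \<beta> x + k" using s by simp
  then show "expansion \<beta> x (- 1 - int k) =
      nat \<lfloor>\<beta> (- 1 - int k) * greedy_rem \<beta> x (int_length \<beta> x + k)\<rfloor>"
    using s by (simp add: expansion_def)
  have "start_index \<beta> x - int (int_length \<beta> x + k) = - 1 - int k" using s by simp
  then show "greedy_rem \<beta> x (int_length \<beta> x + Suc k) =
      (let y = \<beta> (- 1 - int k) * greedy_rem \<beta> x (int_length \<beta> x + k) in y - of_int \<lfloor>y\<rfloor>)"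
    by (simp only: add_Suc_right greedy_rem.simps)
qed

section \<open>The set of integers of a base\<close>

text \<open>This is where the divergence of the product over the negative indices is used: a nonzero
  remainder at the radix point produces a nonzero digit after it.\<close>

lemma B_integers_eq:
  assumes "two_way_cantor_base \<beta>"
  shows "B_integers \<beta> = {x. 0 \<le> x \<and> int_part \<beta> x = x}"
proof (intro Collect_cong[THEN trans[OF B_integers_def]] conj_cong refl)
  fix x :: real assume x: "0 \<le> x"
  note gr = greedy_rem_after_point[OF assms x]
  define r where "r k = greedy_rem \<beta> x (int_length \<beta> x + k)" for k
  have r0: "r 0 = frac_part \<beta> x" by (simp add: r_def frac_part_def)
  show "(\<forall>n<0. expansion \<beta> x n = 0) \<longleftrightarrow> int_part \<beta> x = x"
  proof
    assume zero: "\<forall>n<0. expansion \<beta> x n = 0"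
    have r: "r k = frac_part \<beta> x * (\<Prod>i=1..k. \<beta> (- int i)) \<and> 0 \<le> r k \<and> r k < 1" for k
    proof (induction k)
      case 0
      then show ?case using r0 gr(1,2) by simp
    next
      case (Suc k)
      define y where "y = \<beta> (- 1 - int k) * r k"
      have "0 \<le> y" using Suc base_pos[OF assms, of "- 1 - int k"] by (simp add: y_def)
      moreover have "nat \<lfloor>y\<rfloor> = 0"
        using gr(3)[of k] zero by (simp add: y_def r_def)
      ultimately have "\<lfloor>y\<rfloor> = 0" by (simp add: nat_eq_iff)
      then have "y < 1" by linarith
      moreover have "r (Suc k) = y"
        using gr(4)[of k] \<open>\<lfloor>y\<rfloor> = 0\<close> by (simp add: r_def y_def Let_def)
      ultimately show ?case
        using Suc \<open>0 \<le> y\<close> by (simp add: y_def mult_ac)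
    qed
    have "frac_part \<beta> x = 0"
    proof (rule ccontr)
      assume "frac_part \<beta> x \<noteq> 0"
      then have pos: "frac_part \<beta> x > 0" using gr(1) by simp
      have "filterlim (\<lambda>k. \<Prod>i=1..k. \<beta> (- int i)) at_top sequentially"
        using assms by (simp add: two_way_cantor_base_def)
      then have "\<forall>\<^sub>F k in sequentially. 1 / frac_part \<beta> x < (\<Prod>i=1..k. \<beta> (- int i))"
        by (simp only: filterlim_at_top_dense)
      then obtain k where "1 / frac_part \<beta> x < (\<Prod>i=1..k. \<beta> (- int i))"
        by (meson eventually_happens' sequentially_bot)
      then have "1 < r k" using r[of k] pos by (simp add: field_simps)
      then show False using r[of k] by simp
    qed
    then show "int_part \<beta> x = x" by (simp add: int_part_def)
  next
    assume "int_part \<beta> x = x"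
    then have f0: "frac_part \<beta> x = 0" by (simp add: int_part_def)
    have r: "r k = 0" for k
    proof (induction k)
      case 0
      then show ?case using r0 f0 by simp
    next
      case (Suc k)
      then show ?case using gr(4)[of k] by (simp add: r_def)
    qed
    show "\<forall>n<0. expansion \<beta> x n = 0"
    proof (intro allI impI)
      fix n :: int assume "n < 0"
      define k where "k = nat (- 1 - n)"
      have "n = - 1 - int k" using \<open>n < 0\<close> by (simp add: k_def)
      then show "expansion \<beta> x n = 0" using gr(3)[of k] r[of k] by (simp add: r_def)
    qed
  qed
qed

lemma B_integer_iff:
  assumes "two_way_cantor_base \<beta>"
  shows "x \<in> B_integers \<beta> \<longleftrightarrow> 0 \<le> x \<and> int_part \<beta> x = x"
  using B_integers_eq[OF assms] by simp

lemma int_part_in_B_integers: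
  assumes "two_way_cantor_base \<beta>" "0 \<le> x"
  shows "int_part \<beta> x \<in> B_integers \<beta>"
  using int_part_idem[OF assms] int_part_bounds[OF assms] B_integer_iff[OF assms(1)] by simp

lemma zero_in_B_integers: "two_way_cantor_base \<beta> \<Longrightarrow> 0 \<in> B_integers \<beta>"
  by (simp add: B_integer_iff int_part_less_1)

lemma B_integer_less_1:
  assumes "two_way_cantor_base \<beta>" "x \<in> B_integers \<beta>" "x < 1"
  shows "x = 0"
  using assms by (simp add: B_integer_iff int_part_less_1)

lemma B_integer_nonneg: "x \<in> B_integers \<beta> \<Longrightarrow> 0 \<le> x"
  by (simp add: B_integers_def)

text \<open>Appending the digit \<open>0\<close>.\<close>

lemma mult_in_B_integers:
  assumes "two_way_cantor_base \<beta>" "y \<in> B_integers (base_shift 1 \<beta>)"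
  shows "\<beta> 0 * y \<in> B_integers \<beta>"
    and "expansion \<beta> (\<beta> 0 * y) 0 = 0"
    and "expansion \<beta> (\<beta> 0 * y) (int (Suc i)) = expansion (base_shift 1 \<beta>) y (int i)"
proof -
  have b0: "\<beta> 0 > 0" using base_pos assms by blast
  have y: "0 \<le> y" "int_part (base_shift 1 \<beta>) y = y"
    using assms two_way_cantor_base_shift1 B_integer_iff by blast+
  then show "\<beta> 0 * y \<in> B_integers \<beta>" "expansion \<beta> (\<beta> 0 * y) 0 = 0"
      "expansion \<beta> (\<beta> 0 * y) (int (Suc i)) = expansion (base_shift 1 \<beta>) y (int i)"
    using int_part_shift[OF assms(1), of "\<beta> 0 * y"] expansion_Suc[OF assms(1), of "\<beta> 0 * y" i] b0
      assms(1)
    by (simp_all add: B_integer_iff)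
qed

lemma base_prod_in_B_integers:
  assumes "two_way_cantor_base \<beta>"
  shows "base_prod \<beta> n \<in> B_integers \<beta>"
  using assms
proof (induction n arbitrary: \<beta>)
  case 0
  have "1 / \<beta> 0 < 1" using base_gt_1[OF 0, of 0] by simp
  then have "int_part \<beta> 1 = 1"
    using int_part_shift(1)[OF 0, of 1] by (simp add: int_part_less_1)
  then show ?case using 0 by (simp add: B_integer_iff)
next
  case (Suc n)
  then show ?case
    using mult_in_B_integers(1) two_way_cantor_base_shift1 by (simp add: base_prod_Suc_shift)
qed

lemma finite_B_integers_less:
  assumes "two_way_cantor_base \<beta>"
  shows "finite {x \<in> B_integers \<beta>. x < b}"
proof (cases "0 \<le> b")
  case False
  then have "{x \<in> B_integers \<beta>. x < b} = {}" using B_integer_nonneg by fastforce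
  then show ?thesis by (simp only: finite.emptyI)
next
  case True
  with assms show ?thesis
  proof (induction rule: shift_induct)
    case (less_1 \<beta> b)
    then have "{x \<in> B_integers \<beta>. x < b} \<subseteq> {0}" using B_integer_less_1 by fastforce
    then show ?case by (rule finite_subset) simp
  next
    case (shift \<beta> b)
    have b0: "\<beta> 0 > 0" using base_pos shift.hyps by blast
    let ?Y = "{y \<in> B_integers (base_shift 1 \<beta>). y < b / \<beta> 0}"
    have "{x \<in> B_integers \<beta>. x < b} \<subseteq> (\<lambda>(y, a). \<beta> 0 * y + of_int a) ` (?Y \<times> {0..\<lfloor>b\<rfloor>})"
    proof
      fix x assume "x \<in> {x \<in> B_integers \<beta>. x < b}"
      then have x: "0 \<le> x" "int_part \<beta> x = x" "x < b"
        using B_integer_iff shift.hyps by auto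
      define q where "q = int_part (base_shift 1 \<beta>) (x / \<beta> 0)"
      have q: "q \<in> B_integers (base_shift 1 \<beta>)" "0 \<le> q" "q \<le> x / \<beta> 0"
        using int_part_in_B_integers int_part_bounds[of "base_shift 1 \<beta>" "x / \<beta> 0"]
          shift.hyps x b0
        by (simp_all add: q_def)
      have "x / \<beta> 0 < b / \<beta> 0" using x b0 by (simp add: divide_strict_right_mono)
      then have "q \<in> ?Y" using q by simp
      moreover have "0 \<le> \<beta> 0 * q" "\<beta> 0 * q \<le> x" using q b0 by (simp_all add: field_simps)
      then have "\<lfloor>x - \<beta> 0 * q\<rfloor> \<in> {0..\<lfloor>b\<rfloor>}"
        using x by (auto intro: floor_mono)
      moreover have "x = \<beta> 0 * q + of_int \<lfloor>x - \<beta> 0 * q\<rfloor>"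
        using int_part_shift(1) shift.hyps x by (simp add: q_def)
      ultimately show "x \<in> (\<lambda>(y, a). \<beta> 0 * y + of_int a) ` (?Y \<times> {0..\<lfloor>b\<rfloor>})"
        by (intro image_eqI[where x = "(q, \<lfloor>x - \<beta> 0 * q\<rfloor>)"]) auto
    qed
    moreover have "finite (?Y \<times> {0..\<lfloor>b\<rfloor>})" using shift.IH by simp
    ultimately show ?case by (meson finite_imageI finite_subset)
  qed
qed

lemma B_integer_greater:
  assumes "two_way_cantor_base \<beta>"
  shows "\<exists>y \<in> B_integers \<beta>. x < y"
  using ex_less_base_prod[OF assms] base_prod_in_B_integers[OF assms] by blast

section \<open>Increasing enumerations\<close>

lemma strict_mono_range_unique:
  fixes x z :: "nat \<Rightarrow> 'a :: linorder"
  assumes "strict_mono x" "strict_mono z" "range x = range z"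
  shows "x = z"
proof
  fix n
  show "x n = z n"
  proof (induction n rule: less_induct)
    case (less n)
    have aux: "\<not> u n < v n" if u: "strict_mono u" and v: "strict_mono v"
      and rng: "range u = range v" and eq: "\<forall>m<n. u m = v m" for u v :: "nat \<Rightarrow> 'a"
    proof
      assume lt: "u n < v n"
      obtain m where m: "u n = v m" using rng by (metis rangeE rangeI)
      then have "m < n" using lt v by (simp add: strict_mono_less)
      then have "u m = u n" using eq m by simp
      then show False using \<open>m < n\<close> u by (metis less_irrefl strict_mono_less)
    qed
    show ?case using aux[of x z] aux[of z x] assms less by force
  qed
qed

lemma ex1_increasing_enumeration:
  fixes S :: "'a :: linorder set"
  assumes fin: "\<And>b. finite {s \<in> S. s < b}" and ne: "S \<noteq> {}"
    and unb: "\<And>s. \<exists>t\<in>S. s < t"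
  shows "\<exists>!x :: nat \<Rightarrow> 'a. strict_mono x \<and> range x = S"
proof -
  have fin_le: "finite {s \<in> S. s \<le> b}" for b
    by (rule finite_subset[of _ "insert b {s \<in> S. s < b}"]) (use fin[of b] in auto)
  have least: "\<exists>t\<in>S. P t \<and> (\<forall>u\<in>S. P u \<longrightarrow> t \<le> u)" if "t0 \<in> S" "P t0" for P t0
  proof -
    let ?A = "{t \<in> S. t \<le> t0} \<inter> {t. P t}"
    have A: "finite ?A" "?A \<noteq> {}" using fin_le that by auto
    have "Min ?A \<in> ?A" by (rule Min_in[OF A])
    moreover have "Min ?A \<le> u" if "u \<in> S" "P u" for u
    proof (cases "u \<le> t0")
      case True
      then show ?thesis using that A by (intro Min_le) auto
    next
      case False
      then show ?thesis using \<open>Min ?A \<in> ?A\<close> by auto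
    qed
    ultimately show ?thesis by blast
  qed
  define P where "P n s \<longleftrightarrow> s \<in> S \<and> (n = 0 \<longrightarrow> (\<forall>t\<in>S. s \<le> t))" for n :: nat and s
  define Q where "Q (n :: nat) s t \<longleftrightarrow> s < t \<and> (\<forall>u\<in>S. s < u \<longrightarrow> t \<le> u)" for n s t
  have "\<exists>x. \<forall>n. P n (x n) \<and> Q n (x n) (x (Suc n))"
  proof (rule dependent_nat_choice)
    show "\<exists>s. P 0 s" using least[where P = "\<lambda>_. True"] ne by (auto simp: P_def)
    fix s n
    show "\<exists>t. P (Suc n) t \<and> Q n s t"
      using unb[of s] least[where P = "\<lambda>t. s < t"] by (auto simp: P_def Q_def)
  qed
  then obtain x where x: "\<And>n. P n (x n)" "\<And>n. Q n (x n) (x (Suc n))" by blast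
  have mono: "strict_mono x" using x by (simp add: strict_mono_Suc_iff Q_def)
  have "s \<in> range x" if "s \<in> S" for s
  proof (rule ccontr)
    assume s: "s \<notin> range x"
    have "x n < s" for n
    proof (induction n)
      case 0
      have "x 0 \<le> s" using x(1)[of 0] that by (simp add: P_def)
      then show ?case using s by (metis order_le_less rangeI)
    next
      case (Suc n)
      then have "x (Suc n) \<le> s" using x(2)[of n] that by (simp add: Q_def)
      then show ?case using s by (metis order_le_less rangeI)
    qed
    then have "range x \<subseteq> {t \<in> S. t < s}" using x(1) by (auto simp: P_def)
    then have "finite (range x)" using fin finite_subset by blast
    then show False using mono strict_mono_imp_inj_on finite_imageD infinite_UNIV_nat by blast
  qed
  then have "range x = S" using x(1) by (auto simp: P_def)
  with mono show ?thesis by (blast intro: strict_mono_range_unique)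
qed

lemma B_integer_enum:
  assumes "two_way_cantor_base \<beta>"
  shows "strict_mono (B_integer_enum \<beta>)" "range (B_integer_enum \<beta>) = B_integers \<beta>"
proof -
  have "\<exists>!x :: nat \<Rightarrow> real. strict_mono x \<and> range x = B_integers \<beta>"
    using finite_B_integers_less[OF assms] zero_in_B_integers[OF assms] B_integer_greater[OF assms]
    by (intro ex1_increasing_enumeration) auto
  from theI'[OF this] show "strict_mono (B_integer_enum \<beta>)"
    "range (B_integer_enum \<beta>) = B_integers \<beta>"
    by (simp_all add: B_integer_enum_def)
qed

text \<open>\<open>x'\<close> is the least \<open>B\<close>-integer greater than the \<open>B\<close>-integer \<open>x\<close>.\<close>

definition consecutive :: "(int \<Rightarrow> real) \<Rightarrow> real \<Rightarrow> real \<Rightarrow> bool" where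
  "consecutive \<beta> x x' \<longleftrightarrow> x \<in> B_integers \<beta> \<and> x' \<in> B_integers \<beta> \<and> x < x' \<and>
     (\<forall>z \<in> B_integers \<beta>. x < z \<longrightarrow> x' \<le> z)"

lemma consecutive_unique: "consecutive \<beta> x y \<Longrightarrow> consecutive \<beta> x z \<Longrightarrow> y = z"
  unfolding consecutive_def by (meson order_antisym)

lemma consecutive_enum:
  assumes "two_way_cantor_base \<beta>"
  shows "consecutive \<beta> (B_integer_enum \<beta> k) (B_integer_enum \<beta> (Suc k))"
  unfolding consecutive_def
proof (intro conjI ballI impI)
  note en = B_integer_enum[OF assms]
  show "B_integer_enum \<beta> k \<in> B_integers \<beta>" "B_integer_enum \<beta> (Suc k) \<in> B_integers \<beta>"
    using en(2) by blast+
  show "B_integer_enum \<beta> k < B_integer_enum \<beta> (Suc k)" using en(1) by (simp add: strict_mono_less)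
  fix z assume "z \<in> B_integers \<beta>" "B_integer_enum \<beta> k < z"
  then obtain m where m: "z = B_integer_enum \<beta> m" using en(2) by blast
  then have "k < m" using \<open>B_integer_enum \<beta> k < z\<close> en(1) by (simp add: strict_mono_less)
  then show "B_integer_enum \<beta> (Suc k) \<le> z" using m en(1) by (simp add: strict_mono_less_eq)
qed

lemma B_integer_enum_0:
  assumes "two_way_cantor_base \<beta>"
  shows "B_integer_enum \<beta> 0 = 0"
proof -
  note en = B_integer_enum[OF assms]
  obtain m where "B_integer_enum \<beta> m = 0"
    using en(2) zero_in_B_integers[OF assms] by (metis rangeE)
  moreover have "B_integer_enum \<beta> 0 \<le> B_integer_enum \<beta> m"
    using en(1) by (simp add: strict_mono_less_eq)
  moreover have "0 \<le> B_integer_enum \<beta> 0" using en(2) B_integer_nonneg by blast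
  ultimately show ?thesis by simp
qed

lemma consecutive_exists:
  assumes "two_way_cantor_base \<beta>" "x \<in> B_integers \<beta>"
  shows "\<exists>x'. consecutive \<beta> x x'"
  using consecutive_enum[OF assms(1)] B_integer_enum(2)[OF assms(1)] assms(2) by (metis rangeE)

section \<open>Blocks of integers sharing all digits but the last\<close>

lemma int_part_between:
  assumes "two_way_cantor_base \<beta>" "consecutive \<beta> y y'" "y \<le> u" "u < y'"
  shows "int_part \<beta> u = y"
proof -
  have y: "0 \<le> y" "int_part \<beta> y = y"
    using assms(1,2) B_integer_iff by (auto simp: consecutive_def)
  have u: "0 \<le> u" using y assms(3) by simp
  have "y \<le> int_part \<beta> u" using int_part_mono[OF assms(1), of y u] y assms(3) by simp
  moreover have "int_part \<beta> u < y'" using int_part_bounds[OF assms(1) u] assms(4) by simp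
  ultimately show ?thesis
    using int_part_in_B_integers[OF assms(1) u] assms(2) unfolding consecutive_def by fastforce
qed

lemma
  assumes "two_way_cantor_base \<beta>" "consecutive (base_shift 1 \<beta>) y y'"
    and "real j < \<beta> 0 * (y' - y)"
  shows block_B_integer: "\<beta> 0 * y + real j \<in> B_integers \<beta>"
    and block_expansion_0: "expansion \<beta> (\<beta> 0 * y + real j) 0 = j"
    and block_expansion_Suc:
      "expansion \<beta> (\<beta> 0 * y + real j) (int (Suc i)) = expansion (base_shift 1 \<beta>) y (int i)"
proof -
  let ?u = "\<beta> 0 * y + real j"
  have T: "two_way_cantor_base (base_shift 1 \<beta>)" using two_way_cantor_base_shift1 assms by blast
  have b0: "\<beta> 0 > 0" using base_pos assms by blast
  have y: "0 \<le> y" "int_part (base_shift 1 \<beta>) y = y"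
    using assms(2) B_integer_iff[OF T] by (auto simp: consecutive_def)
  have u: "0 \<le> ?u" "y \<le> ?u / \<beta> 0" "?u / \<beta> 0 < y'"
    using y b0 assms(3) by (simp_all add: field_simps)
  have ip: "int_part (base_shift 1 \<beta>) (?u / \<beta> 0) = y"
    using int_part_between[OF T assms(2)] u by blast
  show "?u \<in> B_integers \<beta>" "expansion \<beta> ?u 0 = j"
    using int_part_shift[OF assms(1) u(1)] ip u(1) assms(1) by (simp_all add: B_integer_iff)
  have "0 \<le> ?u / \<beta> 0" using u(2) y(1) by simp
  then show "expansion \<beta> ?u (int (Suc i)) = expansion (base_shift 1 \<beta>) y (int i)"
    using expansion_Suc[OF assms(1) u(1)] expansion_eq_if_int_part_eq[OF T _ y(1), of "?u / \<beta> 0"]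
      ip y(2) by simp
qed

lemma B_integer_in_block:
  assumes "two_way_cantor_base \<beta>" "consecutive (base_shift 1 \<beta>) y y'"
    and "u \<in> B_integers \<beta>" "\<beta> 0 * y \<le> u" "u < \<beta> 0 * y'"
  shows "\<exists>j. u = \<beta> 0 * y + real j"
proof -
  have T: "two_way_cantor_base (base_shift 1 \<beta>)" using two_way_cantor_base_shift1 assms by blast
  have b0: "\<beta> 0 > 0" using base_pos assms by blast
  have "int_part (base_shift 1 \<beta>) (u / \<beta> 0) = y"
    using assms(4,5) b0 by (intro int_part_between[OF T assms(2)]) (simp_all add: field_simps)
  then have "u = \<beta> 0 * y + of_int \<lfloor>u - \<beta> 0 * y\<rfloor>"
    using int_part_shift(1)[OF assms(1), of u] assms(1,3) by (simp add: B_integer_iff)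
  moreover have "\<lfloor>u - \<beta> 0 * y\<rfloor> = int (nat \<lfloor>u - \<beta> 0 * y\<rfloor>)" using assms(4) by simp
  ultimately show ?thesis by (metis of_int_of_nat_eq)
qed

text \<open>The index \<open>n\<close> is the greatest nonnegative index at which the expansions of \<open>x\<close> and \<open>y\<close>
  differ. For consecutive \<open>B\<close>-integers \<open>x\<close> and \<open>y\<close>, this is the letter that the pair
  contributes to \<open>w\<^sub>B\<close>.\<close>

definition leading_difference :: "(int \<Rightarrow> real) \<Rightarrow> real \<Rightarrow> real \<Rightarrow> nat \<Rightarrow> bool" where
  "leading_difference \<beta> x y n \<longleftrightarrow> expansion \<beta> x (int n) \<noteq> expansion \<beta> y (int n) \<and>
     (\<forall>m>n. expansion \<beta> x (int m) = expansion \<beta> y (int m))"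

lemma leading_difference_unique:
  "leading_difference \<beta> x y m \<Longrightarrow> leading_difference \<beta> x y n \<Longrightarrow> m = n"
  unfolding leading_difference_def by (meson linorder_neqE_nat)

lemma w_seq_eq:
  assumes "leading_difference \<beta> (B_integer_enum \<beta> k) (B_integer_enum \<beta> (Suc k)) n"
  shows "w_seq \<beta> k = n"
  unfolding w_seq_def
  by (rule Greatest_equality) (use assms in \<open>auto simp: leading_difference_def not_less[symmetric]\<close>)

lemma block_step:
  assumes "two_way_cantor_base \<beta>" "consecutive (base_shift 1 \<beta>) y y'"
    and "real (Suc j) < \<beta> 0 * (y' - y)"
  shows "consecutive \<beta> (\<beta> 0 * y + real j) (\<beta> 0 * y + real (Suc j))"
    and "leading_difference \<beta> (\<beta> 0 * y + real j) (\<beta> 0 * y + real (Suc j)) 0"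
proof -
  have j: "real j < \<beta> 0 * (y' - y)" using assms(3) by simp
  note B = block_B_integer[OF assms(1,2)]
  show "consecutive \<beta> (\<beta> 0 * y + real j) (\<beta> 0 * y + real (Suc j))"
    unfolding consecutive_def
  proof (intro conjI ballI impI)
    fix z assume z: "z \<in> B_integers \<beta>" "\<beta> 0 * y + real j < z"
    show "\<beta> 0 * y + real (Suc j) \<le> z"
    proof (cases "z < \<beta> 0 * y'")
      case True
      then obtain i where "z = \<beta> 0 * y + real i"
        using B_integer_in_block[OF assms(1,2) z(1)] z(2) by auto
      then show ?thesis using z(2) by simp
    next
      case False
      then show ?thesis using assms(3) by (simp add: algebra_simps)
    qed
  qed (use B[OF j] B[OF assms(3)] in auto)
  show "leading_difference \<beta> (\<beta> 0 * y + real j) (\<beta> 0 * y + real (Suc j)) 0"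
    unfolding leading_difference_def
  proof (intro conjI allI impI)
    show "expansion \<beta> (\<beta> 0 * y + real j) (int 0) \<noteq> expansion \<beta> (\<beta> 0 * y + real (Suc j)) (int 0)"
      using block_expansion_0[OF assms(1,2) j] block_expansion_0[OF assms] by simp
    fix m :: nat assume "0 < m"
    then obtain i where "m = Suc i" using gr0_implies_Suc by blast
    then show "expansion \<beta> (\<beta> 0 * y + real j) (int m) = expansion \<beta> (\<beta> 0 * y + real (Suc j)) (int m)"
      using block_expansion_Suc[OF assms(1,2) j] block_expansion_Suc[OF assms] by metis
  qed
qed

lemma block_end:
  assumes "two_way_cantor_base \<beta>" "consecutive (base_shift 1 \<beta>) y y'"
    and "real j < \<beta> 0 * (y' - y)" "\<beta> 0 * (y' - y) \<le> real (Suc j)"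
  shows "consecutive \<beta> (\<beta> 0 * y + real j) (\<beta> 0 * y')"
    and "leading_difference (base_shift 1 \<beta>) y y' n \<Longrightarrow>
      leading_difference \<beta> (\<beta> 0 * y + real j) (\<beta> 0 * y') (Suc n)"
proof -
  have y': "y' \<in> B_integers (base_shift 1 \<beta>)" using assms(2) by (simp add: consecutive_def)
  note B = block_B_integer[OF assms(1-3)] mult_in_B_integers[OF assms(1) y']
  show "consecutive \<beta> (\<beta> 0 * y + real j) (\<beta> 0 * y')"
    unfolding consecutive_def
  proof (intro conjI ballI impI)
    show "\<beta> 0 * y + real j < \<beta> 0 * y'" using assms(3) by (simp add: algebra_simps)
    fix z assume z: "z \<in> B_integers \<beta>" "\<beta> 0 * y + real j < z"
    show "\<beta> 0 * y' \<le> z"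
    proof (rule ccontr)
      assume "\<not> \<beta> 0 * y' \<le> z"
      moreover then obtain i where i: "z = \<beta> 0 * y + real i"
        using B_integer_in_block[OF assms(1,2) z(1)] z(2) by auto
      moreover have "Suc j \<le> i" using i z(2) by simp
      then have "real (Suc j) \<le> real i" by (simp only: of_nat_le_iff)
      ultimately show False using assms(4) by (simp add: algebra_simps)
    qed
  qed (use B in auto)
  assume lead: "leading_difference (base_shift 1 \<beta>) y y' n"
  show "leading_difference \<beta> (\<beta> 0 * y + real j) (\<beta> 0 * y') (Suc n)"
    unfolding leading_difference_def
  proof (intro conjI allI impI)
    show "expansion \<beta> (\<beta> 0 * y + real j) (int (Suc n)) \<noteq> expansion \<beta> (\<beta> 0 * y') (int (Suc n))"
      using lead block_expansion_Suc[OF assms(1-3)] B(4) unfolding leading_difference_def by metis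
    fix m :: nat assume "Suc n < m"
    then obtain i where "m = Suc i" "n < i" by (metis Suc_lessE)
    then show "expansion \<beta> (\<beta> 0 * y + real j) (int m) = expansion \<beta> (\<beta> 0 * y') (int m)"
      using lead block_expansion_Suc[OF assms(1-3)] B(4) unfolding leading_difference_def by metis
  qed
qed

text \<open>Every pair of consecutive \<open>B\<close>-integers is either a step inside a block, as in \<open>block_step\<close>,
  or the step from the last element of a block to the next block, as in \<open>block_end\<close>.\<close>

lemma consecutive_cases:
  assumes "two_way_cantor_base \<beta>" "consecutive \<beta> x x'"
  obtains (inside) "x' = x + 1" "leading_difference \<beta> x x' 0" "expansion \<beta> x' 0 \<noteq> 0"
  | (last) y y' j where "consecutive (base_shift 1 \<beta>) y y'" "x = \<beta> 0 * y + real j" "x' = \<beta> 0 * y'"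
      "real j < \<beta> 0 * (y' - y)" "\<beta> 0 * (y' - y) \<le> real (Suc j)"
proof -
  have T: "two_way_cantor_base (base_shift 1 \<beta>)" using two_way_cantor_base_shift1 assms by blast
  have b0: "\<beta> 0 > 0" using base_pos assms by blast
  have x: "x \<in> B_integers \<beta>" "0 \<le> x" using assms(2) B_integer_nonneg by (auto simp: consecutive_def)
  define y where "y = int_part (base_shift 1 \<beta>) (x / \<beta> 0)"
  have y: "y \<in> B_integers (base_shift 1 \<beta>)" "y \<le> x / \<beta> 0"
    using int_part_in_B_integers[OF T] int_part_bounds[OF T, of "x / \<beta> 0"] x b0
    by (simp_all add: y_def)
  obtain y' where y': "consecutive (base_shift 1 \<beta>) y y'" using consecutive_exists[OF T y(1)] by blast
  have "x / \<beta> 0 < y'"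
  proof (rule ccontr)
    assume "\<not> x / \<beta> 0 < y'"
    moreover have "0 \<le> y'" "int_part (base_shift 1 \<beta>) y' = y'"
      using y' B_integer_iff[OF T] by (auto simp: consecutive_def)
    ultimately have "y' \<le> y" using int_part_mono[OF T, of y' "x / \<beta> 0"] by (simp add: y_def)
    then show False using y' by (simp add: consecutive_def)
  qed
  then have "\<beta> 0 * y \<le> x" "x < \<beta> 0 * y'" using y b0 by (simp_all add: field_simps)
  then obtain j where j: "x = \<beta> 0 * y + real j"
    using B_integer_in_block[OF assms(1) y' x(1)] by blast
  have jlt: "real j < \<beta> 0 * (y' - y)" using j \<open>x < \<beta> 0 * y'\<close> by (simp add: algebra_simps)
  show thesis
  proof (cases "real (Suc j) < \<beta> 0 * (y' - y)")
    case True
    note step = block_step[OF assms(1) y' True, folded j]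
    have x': "x' = \<beta> 0 * y + real (Suc j)" using consecutive_unique[OF assms(2) step(1)] .
    then have "expansion \<beta> x' 0 \<noteq> 0" using block_expansion_0[OF assms(1) y' True] by simp
    moreover have "x' = x + 1" using x' j by simp
    moreover have "leading_difference \<beta> x x' 0" using step(2) x' by simp
    ultimately show thesis using inside by blast
  next
    case False
    then have le: "\<beta> 0 * (y' - y) \<le> real (Suc j)" by simp
    have "x' = \<beta> 0 * y'"
      using consecutive_unique[OF assms(2) block_end(1)[OF assms(1) y' jlt le, folded j]] .
    then show thesis using last y' j jlt le by blast
  qed
qed

lemma leading_difference_exists:
  assumes "two_way_cantor_base \<beta>" "consecutive \<beta> x x'"
  shows "\<exists>n. leading_difference \<beta> x x' n"
proof -
  have "0 \<le> x'" using assms(2) B_integer_nonneg by (auto simp: consecutive_def)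
  with assms(1) have "\<forall>x. consecutive \<beta> x x' \<longrightarrow> (\<exists>n. leading_difference \<beta> x x' n)"
  proof (induction rule: shift_induct)
    case (less_1 \<beta> x')
    have "\<not> consecutive \<beta> x x'" for x
      using B_integer_less_1[of \<beta> x'] B_integer_nonneg[of x \<beta>] less_1
      by (auto simp: consecutive_def)
    then show ?case by blast
  next
    case (shift \<beta> x')
    show ?case
    proof (intro allI impI)
      fix x assume "consecutive \<beta> x x'"
      with shift.hyps(1) show "\<exists>n. leading_difference \<beta> x x' n"
      proof (cases rule: consecutive_cases)
        case inside
        then show ?thesis by blast
      next
        case (last y y' j)
        have "y' = x' / \<beta> 0" using last base_pos[of \<beta> 0] shift.hyps by simp
        then obtain n where "leading_difference (base_shift 1 \<beta>) y y' n" using shift.IH last by blast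
        then show ?thesis using block_end(2) last shift.hyps(1) by blast
      qed
    qed
  qed
  then show ?thesis using assms(2) by blast
qed

section \<open>Gaps between consecutive integers\<close>

lemma nat_below_unique:
  assumes "real i < t" "t \<le> real (Suc i)" "real j < t" "t \<le> real (Suc j)"
  shows "i = j"
  using assms by linarith

text \<open>A pair of consecutive integers with letter \<open>n + 1\<close> ends a block, and the pair of
  \<open>S B\<close>-integers from which that block comes has letter \<open>n\<close>.\<close>

lemma consecutive_Suc_cases:
  assumes "two_way_cantor_base \<beta>" "consecutive \<beta> x x'" "leading_difference \<beta> x x' (Suc n)"
  obtains y y' j where "consecutive (base_shift 1 \<beta>) y y'"
    "leading_difference (base_shift 1 \<beta>) y y' n" "x = \<beta> 0 * y + real j" "x' = \<beta> 0 * y'"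
    "real j < \<beta> 0 * (y' - y)" "\<beta> 0 * (y' - y) \<le> real (Suc j)"
  using assms(1,2)
proof (cases rule: consecutive_cases)
  case inside
  then show ?thesis using leading_difference_unique assms(3) by blast
next
  case (last y y' j)
  obtain m where m: "leading_difference (base_shift 1 \<beta>) y y' m"
    using leading_difference_exists two_way_cantor_base_shift1 assms(1) last(1) by blast
  then have "leading_difference \<beta> x x' (Suc m)"
    using block_end(2)[OF assms(1) last(1,4,5)] last(2,3) by simp
  then have "m = n" using leading_difference_unique assms(3) by blast
  then show ?thesis using that last m by blast
qed

lemma gap_eq:
  assumes "two_way_cantor_base \<beta>"
    and "consecutive \<beta> x x'" "leading_difference \<beta> x x' n"
    and "consecutive \<beta> z z'" "leading_difference \<beta> z z' n"
  shows "x' - x = z' - z"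
  using assms
proof (induction n arbitrary: \<beta> x x' z z')
  case 0
  have "u' - u = 1" if "consecutive \<beta> u u'" "leading_difference \<beta> u u' 0" for u u'
    using "0.prems"(1) that(1)
  proof (cases rule: consecutive_cases)
    case inside
    then show ?thesis by simp
  next
    case (last y y' j)
    obtain m where "leading_difference (base_shift 1 \<beta>) y y' m"
      using leading_difference_exists two_way_cantor_base_shift1 "0.prems"(1) last(1) by blast
    then have "leading_difference \<beta> u u' (Suc m)"
      using block_end(2)[OF "0.prems"(1) last(1,4,5)] last(2,3) by simp
    then show ?thesis using leading_difference_unique that(2) by blast
  qed
  then show ?case using 0 by simp
next
  case (Suc n)
  obtain y y' j where y: "consecutive (base_shift 1 \<beta>) y y'"
    "leading_difference (base_shift 1 \<beta>) y y' n" "x = \<beta> 0 * y + real j" "x' = \<beta> 0 * y'"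
    "real j < \<beta> 0 * (y' - y)" "\<beta> 0 * (y' - y) \<le> real (Suc j)"
    using consecutive_Suc_cases Suc.prems(1-3) by blast
  obtain v v' i where v: "consecutive (base_shift 1 \<beta>) v v'"
    "leading_difference (base_shift 1 \<beta>) v v' n" "z = \<beta> 0 * v + real i" "z' = \<beta> 0 * v'"
    "real i < \<beta> 0 * (v' - v)" "\<beta> 0 * (v' - v) \<le> real (Suc i)"
    using consecutive_Suc_cases Suc.prems(1,4,5) by blast
  have gap: "y' - y = v' - v"
    using Suc.IH y v two_way_cantor_base_shift1 Suc.prems(1) by blast
  have "j = i" using nat_below_unique[of j "\<beta> 0 * (v' - v)" i] y(5,6) v(5,6) gap by simp
  have "x' - x = \<beta> 0 * (y' - y) - real j" using y by (simp add: algebra_simps)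
  also have "\<dots> = \<beta> 0 * (v' - v) - real i" using gap \<open>j = i\<close> by simp
  also have "\<dots> = z' - z" using v by (simp add: algebra_simps)
  finally show ?case .
qed

lemma leading_difference_base_prod:
  assumes "two_way_cantor_base \<beta>" "consecutive \<beta> x (base_prod \<beta> n)"
  shows "leading_difference \<beta> x (base_prod \<beta> n) n"
  using assms
proof (induction n arbitrary: \<beta> x)
  case 0
  then show ?case
  proof (cases rule: consecutive_cases)
    case (last y y' j)
    have "y' = 1 / \<beta> 0" using last(3) base_pos[OF 0(1), of 0] by (simp add: field_simps)
    then have "y' < 1" using base_gt_1[OF 0(1), of 0] by simp
    then have "y' = 0"
      using last(1) B_integer_less_1 two_way_cantor_base_shift1[OF 0(1)]
      by (auto simp: consecutive_def)
    then show ?thesis using last(3) by simp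
  qed simp
next
  case (Suc n)
  have T: "two_way_cantor_base (base_shift 1 \<beta>)" using two_way_cantor_base_shift1 Suc by blast
  from Suc.prems show ?case
  proof (cases rule: consecutive_cases)
    case inside
    \<comment> \<open>Impossible: the last digit of the product of \<open>n + 1\<close> bases is \<open>0\<close>.\<close>
    then show ?thesis
      using mult_in_B_integers(2)[OF Suc.prems(1) base_prod_in_B_integers[OF T, of n]]
      by (simp add: base_prod_Suc_shift)
  next
    case (last y y' j)
    have "y' = base_prod (base_shift 1 \<beta>) n"
      using last(3) base_pos[OF Suc.prems(1), of 0] by (simp add: base_prod_Suc_shift)
    then have "leading_difference (base_shift 1 \<beta>) y y' n" using Suc.IH T last(1) by blast
    then show ?thesis using block_end(2)[OF Suc.prems(1) last(1,4,5)] last(2,3) by simp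
  qed
qed

lemma consecutive_max_B_integer:
  assumes "two_way_cantor_base \<beta>"
  shows "consecutive \<beta> (max_B_integer \<beta> n) (base_prod \<beta> n)"
proof -
  let ?A = "{x \<in> B_integers \<beta>. x < base_prod \<beta> n}"
  have "0 < base_prod \<beta> n"
    unfolding base_prod_def using base_pos[OF assms] by (simp add: prod_pos)
  then have A: "finite ?A" "?A \<noteq> {}"
    using finite_B_integers_less[OF assms] zero_in_B_integers[OF assms] by auto
  have "max_B_integer \<beta> n \<in> ?A" unfolding max_B_integer_def by (rule Max_in[OF A])
  moreover have "base_prod \<beta> n \<le> z" if "z \<in> B_integers \<beta>" "max_B_integer \<beta> n < z" for z
  proof (rule ccontr)
    assume "\<not> base_prod \<beta> n \<le> z"
    then have "z \<le> max_B_integer \<beta> n"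
      unfolding max_B_integer_def using that(1) by (intro Max_ge[OF A(1)]) simp
    then show False using that(2) by simp
  qed
  ultimately show ?thesis
    using base_prod_in_B_integers[OF assms] by (simp add: consecutive_def)
qed

text \<open>By these two inequalities, \<open>\<beta> 0 * y + real j\<close> runs over the block of \<open>y\<close> as \<open>j\<close> runs from
  \<open>0\<close> to the number of letters \<open>0\<close> in the image of the letter \<open>n\<close>.\<close>

lemma max_digit_eq:
  assumes "two_way_cantor_base \<beta>"
    and "consecutive (base_shift 1 \<beta>) y y'" "leading_difference (base_shift 1 \<beta>) y y' n"
  shows "real (max_digit \<beta> (Suc n) 0) < \<beta> 0 * (y' - y)"
    and "\<beta> 0 * (y' - y) \<le> real (Suc (max_digit \<beta> (Suc n) 0))"
proof -
  note M = consecutive_max_B_integer[OF assms(1), of "Suc n"]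
  obtain v v' j where v: "consecutive (base_shift 1 \<beta>) v v'"
    "leading_difference (base_shift 1 \<beta>) v v' n" "max_B_integer \<beta> (Suc n) = \<beta> 0 * v + real j"
    "real j < \<beta> 0 * (v' - v)" "\<beta> 0 * (v' - v) \<le> real (Suc j)"
    using consecutive_Suc_cases[OF assms(1) M leading_difference_base_prod[OF assms(1) M]] by blast
  have "max_digit \<beta> (Suc n) 0 = j"
    using block_expansion_0[OF assms(1) v(1,4)] v(3) by (simp add: max_digit_def)
  moreover have "v' - v = y' - y"
    using gap_eq[OF two_way_cantor_base_shift1[OF assms(1)] v(1,2) assms(2,3)] .
  ultimately show "real (max_digit \<beta> (Suc n) 0) < \<beta> 0 * (y' - y)"
    "\<beta> 0 * (y' - y) \<le> real (Suc (max_digit \<beta> (Suc n) 0))"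
    using v(4,5) by simp_all
qed

section \<open>The substitutions and their composition\<close>

lemma psi_append: "psi \<beta> (u @ v) = psi \<beta> u @ psi \<beta> v"
  by (simp add: psi_def)

lemma substitution_psi: "substitution (psi \<beta>)"
  by (simp add: substitution_def psi_def)

lemma length_psi: "length u \<le> length (psi \<beta> u)"
  by (induction u) (auto simp: psi_def)

lemma w_seq_leading_difference:
  assumes "two_way_cantor_base \<beta>"
  shows "leading_difference \<beta> (B_integer_enum \<beta> k) (B_integer_enum \<beta> (Suc k)) (w_seq \<beta> k)"
  using leading_difference_exists[OF assms consecutive_enum[OF assms]] w_seq_eq by metis

text \<open>The first \<open>K\<close> letters for the shifted base are mapped to the prefix of \<open>w\<^sub>B\<close> that ends where
  the enumeration of the \<open>B\<close>-integers reaches \<open>\<beta>\<^sub>0 y\<^sub>K\<close>, where \<open>(y\<^sub>k)\<close> enumerates the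
  \<open>S B\<close>-integers.\<close>

lemma psi_prefix:
  assumes "two_way_cantor_base \<beta>"
  shows "\<exists>L. psi \<beta> (map (w_seq (base_shift 1 \<beta>)) [0..<K]) = map (w_seq \<beta>) [0..<L] \<and>
    B_integer_enum \<beta> L = \<beta> 0 * B_integer_enum (base_shift 1 \<beta>) K"
proof (induction K)
  case 0
  then show ?case
    using B_integer_enum_0 assms two_way_cantor_base_shift1[OF assms]
    by (intro exI[of _ 0]) (simp add: psi_def)
next
  case (Suc K)
  have T: "two_way_cantor_base (base_shift 1 \<beta>)" using two_way_cantor_base_shift1 assms by blast
  define y y' n where "y = B_integer_enum (base_shift 1 \<beta>) K"
    and "y' = B_integer_enum (base_shift 1 \<beta>) (Suc K)" and "n = w_seq (base_shift 1 \<beta>) K"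
  define m where "m = max_digit \<beta> (Suc n) 0"
  obtain L where L: "psi \<beta> (map (w_seq (base_shift 1 \<beta>)) [0..<K]) = map (w_seq \<beta>) [0..<L]"
    "B_integer_enum \<beta> L = \<beta> 0 * y"
    using Suc by (auto simp: y_def)
  have yy': "consecutive (base_shift 1 \<beta>) y y'" "leading_difference (base_shift 1 \<beta>) y y' n"
    using consecutive_enum[OF T] w_seq_leading_difference[OF T] by (simp_all add: y_def y'_def n_def)
  have m: "real m < \<beta> 0 * (y' - y)" "\<beta> 0 * (y' - y) \<le> real (Suc m)"
    using max_digit_eq[OF assms yy'] by (simp_all add: m_def)
  have in_block: "B_integer_enum \<beta> (L + j) = \<beta> 0 * y + real j" if "j \<le> m" for j
    using that
  proof (induction j)
    case 0
    then show ?case using L by simp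
  next
    case (Suc j)
    have "real (Suc j) \<le> real m" using Suc.prems by (simp only: of_nat_le_iff)
    then have "real (Suc j) < \<beta> 0 * (y' - y)" using m(1) by linarith
    from block_step(1)[OF assms yy'(1) this] show ?case
      using consecutive_unique consecutive_enum[OF assms, of "L + j"] Suc by simp
  qed
  have at_end: "B_integer_enum \<beta> (Suc (L + m)) = \<beta> 0 * y'"
    using consecutive_unique[OF _ block_end(1)[OF assms yy'(1) m]] consecutive_enum[OF assms, of "L + m"]
      in_block[of m] by simp
  have "w_seq \<beta> (L + j) = 0" if "j < m" for j
  proof -
    have "real (Suc j) \<le> real m" using that by (simp only: of_nat_le_iff Suc_le_eq)
    then have "real (Suc j) < \<beta> 0 * (y' - y)" using m(1) by linarith
    from block_step(2)[OF assms yy'(1) this] show ?thesis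
      using in_block[of j] in_block[of "Suc j"] that by (intro w_seq_eq) simp
  qed
  then have "map (w_seq \<beta>) [L..<L + m] = replicate m 0"
    by (intro nth_equalityI) simp_all
  moreover have "w_seq \<beta> (L + m) = Suc n"
    using block_end(2)[OF assms yy'(1) m yy'(2)] in_block[of m] at_end by (intro w_seq_eq) simp
  ultimately have "map (w_seq \<beta>) [L..<Suc (L + m)] = psi \<beta> [n]"
    by (simp add: psi_def m_def)
  moreover have "[0..<Suc (L + m)] = [0..<L] @ [L..<Suc (L + m)]"
    using upt_add_eq_append[of 0 L "Suc m"] by simp
  ultimately have "psi \<beta> (map (w_seq (base_shift 1 \<beta>)) [0..<Suc K]) = map (w_seq \<beta>) [0..<Suc (L + m)]"
    using L(1) by (simp add: psi_append n_def)
  then show ?case using at_end unfolding y'_def by blast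
qed

lemma w_seq_0:
  assumes "two_way_cantor_base \<beta>"
  shows "w_seq \<beta> 0 = 0"
proof -
  have "max_B_integer \<beta> 0 = 0"
    using consecutive_max_B_integer[OF assms, of 0] B_integer_less_1[OF assms]
    by (simp add: consecutive_def)
  then have c: "consecutive \<beta> 0 (base_prod \<beta> 0)"
    using consecutive_max_B_integer[OF assms, of 0] by simp
  then have "B_integer_enum \<beta> (Suc 0) = base_prod \<beta> 0"
    using consecutive_unique consecutive_enum[OF assms, of 0] B_integer_enum_0[OF assms] by simp
  then show ?thesis
    using leading_difference_base_prod[OF assms c] B_integer_enum_0[OF assms]
    by (intro w_seq_eq) simp
qed

lemma psi_0:
  assumes "two_way_cantor_base \<beta>"
  obtains v where "psi \<beta> [0] = 0 # v" "v \<noteq> []"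
proof -
  obtain L where L: "psi \<beta> [0] = map (w_seq \<beta>) [0..<L]"
    using psi_prefix[OF assms, of 1] w_seq_0[OF two_way_cantor_base_shift1[OF assms]] by auto
  \<comment> \<open>The word on the left ends in the letter \<open>1\<close>, while the one on the right begins with \<open>0\<close>.\<close>
  have "max_digit \<beta> 1 0 \<noteq> 0"
  proof
    assume "max_digit \<beta> 1 0 = 0"
    then have one: "map (w_seq \<beta>) [0..<L] = [1]" using L by (simp add: psi_def)
    then have "L = 1" by (metis length_map length_upt diff_zero length_Cons list.size(3) One_nat_def)
    then show False using one w_seq_0[OF assms] by simp
  qed
  then obtain m where "max_digit \<beta> 1 0 = Suc m" using not0_implies_Suc by blast
  then have "psi \<beta> [0] = 0 # (replicate m 0 @ [1])" by (simp add: psi_def)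
  then show thesis using that by blast
qed

lemma compose_upto_append:
  assumes "\<And>n. substitution (\<sigma> n)"
  shows "compose_upto \<sigma> n (u @ v) = compose_upto \<sigma> n u @ compose_upto \<sigma> n v"
  using assms by (induction n arbitrary: u v) (simp_all add: substitution_def)

lemma length_compose_upto:
  assumes "\<And>n u. length u \<le> length (\<sigma> n u)"
  shows "length u \<le> length (compose_upto \<sigma> n u)"
proof (induction n arbitrary: u)
  case (Suc n)
  show ?case using assms[of u "Suc n"] Suc[of "\<sigma> (Suc n) u"] by simp
qed (use assms in simp)

lemma compose_upto_psi_prefix:
  assumes "two_way_cantor_base \<beta>"
  shows "\<exists>L. compose_upto (\<lambda>i. psi (base_shift (int i) \<beta>)) n
    (map (w_seq (base_shift (int (Suc n)) \<beta>)) [0..<K]) = map (w_seq \<beta>) [0..<L]"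
proof (induction n arbitrary: K)
  case 0
  then show ?case using psi_prefix[OF assms, of K] by auto
next
  case (Suc n)
  have "base_shift 1 (base_shift (int (Suc n)) \<beta>) = base_shift (int (Suc (Suc n))) \<beta>"
    by (simp add: base_shift_base_shift)
  then obtain L where "psi (base_shift (int (Suc n)) \<beta>)
      (map (w_seq (base_shift (int (Suc (Suc n))) \<beta>)) [0..<K]) =
      map (w_seq (base_shift (int (Suc n)) \<beta>)) [0..<L]"
    using psi_prefix[OF two_way_cantor_base_shift[OF assms, of "Suc n"], of K] by auto
  then show ?case using Suc.IH[of L] by simp
qed

theorem corollary14:
  fixes \<beta> :: "int \<Rightarrow> real"
  assumes "two_way_cantor_base \<beta>"
  shows "S_adic_by (\<lambda>n. psi (base_shift (int n) \<beta>)) 0 (w_seq \<beta>)"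
  unfolding S_adic_by_def words_converge_def
proof (intro conjI allI)
  fix n show "substitution (psi (base_shift (int n) \<beta>))" by (rule substitution_psi)
next
  fix k
  define c where "c = compose_upto (\<lambda>n. psi (base_shift (int n) \<beta>))"
  have len: "n < length (c n [0])" for n
  proof (induction n)
    case 0
    show ?case using length_psi[of "[0]" \<beta>] by (simp add: c_def del: length_greater_0_conv)
  next
    case (Suc n)
    obtain v where v: "psi (base_shift (int (Suc n)) \<beta>) [0] = [0] @ v" "v \<noteq> []"
      using psi_0[OF two_way_cantor_base_shift[OF assms, of "Suc n"]] by auto
    have "c (Suc n) [0] = c n ([0] @ v)" using v(1) by (simp add: c_def)
    also have "\<dots> = c n [0] @ c n v"
      unfolding c_def by (rule compose_upto_append) (rule substitution_psi)
    finally have "length (c (Suc n) [0]) = length (c n [0]) + length (c n v)" by simp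
    moreover have "length v \<le> length (c n v)"
      unfolding c_def by (rule length_compose_upto) (rule length_psi)
    moreover have "0 < length v" using v(2) by simp
    ultimately show ?case using Suc by linarith
  qed
  have pre: "\<exists>L. c n [0] = map (w_seq \<beta>) [0..<L]" for n
    using compose_upto_psi_prefix[OF assms, of n 1]
      w_seq_0[OF two_way_cantor_base_shift[OF assms, of "Suc n"]]
    by (simp add: c_def)
  have "take k (c n [0]) = map (w_seq \<beta>) [0..<k]" if "k \<le> n" for n
  proof -
    obtain L where L: "c n [0] = map (w_seq \<beta>) [0..<L]" using pre by blast
    then have "k \<le> L" using len[of n] that by simp
    then show ?thesis using L by (simp add: take_map take_upt)
  qed
  then show "\<forall>\<^sub>F n in sequentially.
      take k (compose_upto (\<lambda>n. psi (base_shift (int n) \<beta>)) n [0]) = map (w_seq \<beta>) [0..<k]"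
    unfolding c_def by (rule eventually_sequentiallyI)
qed

end
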